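(* Let $a<b$ be real numbers, let $\mathcal{N}\ge 0$ and $m\ge 0$ be integers, let $R\in\mathbb{R}^{n\times n}$ be a symmetric positive definite matrix, and let $w_t:[a,b]\to\mathbb{R}^n$ be a continuous function. Then $$\int_a^b (s-a)^m\, w_t(s)^{\mathrm T} R\, w_t(s)\,\mathrm{d}s \;\ge\; F_{\mathcal{N}m}(w_t)^{\mathrm T}\,(\Xi_{\mathcal{N}m}\otimes R)\,F_{\mathcal{N}m}(w_t),$$ where $$F_{\mathcal{N}m}(w_t)=\int_a^b (s-a)^m\,\bigl(F_{\mathcal{N}}(s)\otimes w_t(s)\bigr)\,\mathrm{d}s,\qquad \Xi_{\mathcal{N}m}=G_{\mathcal{N}m}^{-\mathrm T}\Lambda_{\mathcal{N}m}^{-1}G_{\mathcal{N}m}^{-1},\qquad \Lambda_{\mathcal{N}m}=\mathrm{diag}(\chi_{0m},\chi_{1m},\dots,\chi_{\mathcal{N}m}),$$ and $F_{\mathcal{N}}(s)$, $\chi_{km}$ and $G_{\mathcal{N}m}$ are the objects defined in the context.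
   Context: Here $\otimes$ is the Kronecker product of matrices and $X^{-\mathrm T}=(X^{-1})^{\mathrm T}$. The subscript $t$ in $w_t$ is only a parameter (in the application $w_t(s)=w(t+s)$ for a continuous function $w$ and a fixed $t\ge 0$). Let $\mathbb{R}[s]_{\mathcal{N}}$ be the space of real polynomials in $s$ of degree at most $\mathcal{N}$, with basis $f_k(s)=(s-a)^k$, $k=0,1,\dots,\mathcal{N}$, and with inner product $$(p,q)_m=\int_a^b (s-a)^m p(s)q(s)\,\mathrm{d}s .$$ Let $p_{0m},\dots,p_{\mathcal{N}m}$ be the orthogonal basis obtained from $f_0,\dots,f_{\mathcal{N}}$ by the (non-normalized) Gram-Schmidt process: $p_{0m}=f_0$ and $$p_{im}(s)=f_i(s)-\sum_{j=0}^{i-1}\frac{g_{ijm}}{\chi_{jm}}\,p_{jm}(s),\quad i=1,\dots,\mathcal{N},\qquad g_{ijm}=(f_i,p_{jm})_m,\quad \chi_{jm}=(p_{jm},p_{jm})_m .$$ Let $F_{\mathcal{N}}(s)=(f_0(s),f_1(s),\dots,f_{\mathcal{N}}(s))^{\mathrm T}\in\mathbb{R}^{\mathcal{N}+1}$. Let $G_{\mathcal{N}m}$ be the $(\mathcal{N}+1)\times(\mathcal{N}+1)$ unit lower triangular matrix (ones on the diagonal, zeros above it) whose $(i,j)$ entry for $i>j$ (indices from $1$ to $\mathcal{N}+1$) is $g_{i-1,j-1,m}/\chi_{j-1,m}$. *)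

theory Defs
  imports
    "HOL-Analysis.Henstock_Kurzweil_Integration"
    "HOL-Computational_Algebra.Polynomial"
    "Jordan_Normal_Form.Gauss_Jordan_Elimination"
begin

text \<open>The vectors with a natural number as dimension from \<open>Jordan_Normal_Form\<close> carry no topology,
  so continuity and integration are componentwise. The integral takes the dimension as an argument
  because it cannot be read off the integrand.\<close>

definition continuous_on_vec :: "nat \<Rightarrow> real set \<Rightarrow> (real \<Rightarrow> real vec) \<Rightarrow> bool" where
  "continuous_on_vec n S w \<longleftrightarrow>
     (\<forall>s\<in>S. w s \<in> carrier_vec n) \<and> (\<forall>i<n. continuous_on S (\<lambda>s. w s $ i))"

definition integral_vec :: "nat \<Rightarrow> real set \<Rightarrow> (real \<Rightarrow> real vec) \<Rightarrow> real vec" where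
  "integral_vec n S w = vec n (\<lambda>i. integral S (\<lambda>s. w s $ i))"

definition symmetric_mat :: "real mat \<Rightarrow> bool" where
  "symmetric_mat A \<longleftrightarrow> A\<^sup>T = A"

definition pos_def_mat :: "real mat \<Rightarrow> bool" where
  "pos_def_mat A \<longleftrightarrow> square_mat A \<and>
     (\<forall>x \<in> carrier_vec (dim_row A). x \<noteq> 0\<^sub>v (dim_row A) \<longrightarrow> x \<bullet> (A *\<^sub>v x) > 0)"

text \<open>Only meaningful for invertible matrices; otherwise \<open>mat_inverse\<close> returns \<open>None\<close> and the value
  is unspecified.\<close>

definition mat_inv :: "real mat \<Rightarrow> real mat" where
  "mat_inv A = the (mat_inverse A)"

definition kron_mat :: "real mat \<Rightarrow> real mat \<Rightarrow> real mat" (infixl "\<otimes>\<^sub>m" 70) where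
  "A \<otimes>\<^sub>m B = mat (dim_row A * dim_row B) (dim_col A * dim_col B)
     (\<lambda>(i, j). A $$ (i div dim_row B, j div dim_col B) * B $$ (i mod dim_row B, j mod dim_col B))"

text \<open>The case of column vectors, that is, of matrices with a single column.\<close>

definition kron_vec :: "real vec \<Rightarrow> real vec \<Rightarrow> real vec" (infixl "\<otimes>\<^sub>v" 70) where
  "v \<otimes>\<^sub>v w = vec (dim_vec v * dim_vec w) (\<lambda>i. v $ (i div dim_vec w) * w $ (i mod dim_vec w))"

definition inner_m :: "real \<Rightarrow> real \<Rightarrow> nat \<Rightarrow> real poly \<Rightarrow> real poly \<Rightarrow> real" where
  "inner_m a b m p q = integral {a..b} (\<lambda>s. (s - a) ^ m * poly p s * poly q s)"

definition f_poly :: "real \<Rightarrow> nat \<Rightarrow> real poly" where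
  "f_poly a k = [:- a, 1:] ^ k"

fun p_poly :: "real \<Rightarrow> real \<Rightarrow> nat \<Rightarrow> nat \<Rightarrow> real poly" where
  "p_poly a b m i = f_poly a i -
     (\<Sum>j<i. Polynomial.smult (inner_m a b m (f_poly a i) (p_poly a b m j)
                   / inner_m a b m (p_poly a b m j) (p_poly a b m j)) (p_poly a b m j))"

declare p_poly.simps [simp del]

definition g_coeff :: "real \<Rightarrow> real \<Rightarrow> nat \<Rightarrow> nat \<Rightarrow> nat \<Rightarrow> real" where
  "g_coeff a b m i j = inner_m a b m (f_poly a i) (p_poly a b m j)"

definition chi :: "real \<Rightarrow> real \<Rightarrow> nat \<Rightarrow> nat \<Rightarrow> real" where
  "chi a b m j = inner_m a b m (p_poly a b m j) (p_poly a b m j)"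

lemma p_poly_0: "p_poly a b m 0 = f_poly a 0"
  by (subst p_poly.simps) simp

lemma p_poly_rec:
  "p_poly a b m i =
     f_poly a i - (\<Sum>j<i. Polynomial.smult (g_coeff a b m i j / chi a b m j) (p_poly a b m j))"
  by (subst p_poly.simps) (simp add: g_coeff_def chi_def)

text \<open>Indices of vectors and matrices start at 0, so the entry \<open>(i, j)\<close> below is the entry
  \<open>(i + 1, j + 1)\<close> in the numbering from 1 to \<open>N + 1\<close>.\<close>

definition F_vec :: "real \<Rightarrow> nat \<Rightarrow> real \<Rightarrow> real vec" where
  "F_vec a N s = vec (N + 1) (\<lambda>k. poly (f_poly a k) s)"

definition G_mat :: "real \<Rightarrow> real \<Rightarrow> nat \<Rightarrow> nat \<Rightarrow> real mat" where
  "G_mat a b N m = mat (N + 1) (N + 1)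
     (\<lambda>(i, j). if i = j then 1 else if i > j then g_coeff a b m i j / chi a b m j else 0)"

definition Lambda_mat :: "real \<Rightarrow> real \<Rightarrow> nat \<Rightarrow> nat \<Rightarrow> real mat" where
  "Lambda_mat a b N m = mat_diag (N + 1) (chi a b m)"

definition Xi_mat :: "real \<Rightarrow> real \<Rightarrow> nat \<Rightarrow> nat \<Rightarrow> real mat" where
  "Xi_mat a b N m =
     (mat_inv (G_mat a b N m))\<^sup>T * mat_inv (Lambda_mat a b N m) * mat_inv (G_mat a b N m)"

definition F_int :: "real \<Rightarrow> real \<Rightarrow> nat \<Rightarrow> nat \<Rightarrow> nat \<Rightarrow> (real \<Rightarrow> real vec) \<Rightarrow> real vec" where
  "F_int a b n N m w =
     integral_vec ((N + 1) * n) {a..b} (\<lambda>s. (s - a) ^ m \<cdot>\<^sub>v (F_vec a N s \<otimes>\<^sub>v w s))"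

end

theory Submission
  imports
    Defs
    "HOL-Analysis.Equivalence_Lebesgue_Henstock_Integration"
    "Jordan_Normal_Form.Determinant"
begin

text \<open>The inequality is Bessel's inequality for the orthogonal polynomials \<open>p\<^sub>r\<close> in vector form.
  Since \<open>F = G P\<close> with \<open>P = (p\<^sub>0, \<dots>, p\<^sub>N)\<close>, applying \<open>G\<inverse> \<otimes> I\<close> to the moment vector gives the blocks
  \<open>c\<^sub>r = \<integral> (s - a)\<^sup>m p\<^sub>r w\<close>, so the right-hand side equals \<open>\<Sum>\<^sub>r c\<^sub>r\<^sup>T R c\<^sub>r / \<chi>\<^sub>r\<close>. The difference of the
  two sides is the integral of \<open>(s - a)\<^sup>m z\<^sup>T R z\<close>, where \<open>z = w - \<Sum>\<^sub>r p\<^sub>r c\<^sub>r / \<chi>\<^sub>r\<close> is the residual of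
  the orthogonal projection of \<open>w\<close>.\<close>

section \<open>The weighted inner product on continuous functions\<close>

text \<open>Extends \<open>inner_m\<close> from polynomials to arbitrary functions, so that the
  components of \<open>w\<close> can be paired with each other and with the polynomials
  \<open>p_poly\<close>.\<close>

definition weighted_ip ::
  "real \<Rightarrow> real \<Rightarrow> nat \<Rightarrow> (real \<Rightarrow> real) \<Rightarrow> (real \<Rightarrow> real) \<Rightarrow> real" where
  "weighted_ip a b m f g = integral {a..b} (\<lambda>s. (s - a) ^ m * f s * g s)"

lemma weighted_ip_poly: "weighted_ip a b m (poly p) (poly q) = inner_m a b m p q"
  by (simp add: weighted_ip_def inner_m_def)

lemma weighted_ip_commute: "weighted_ip a b m f g = weighted_ip a b m g f"
  unfolding weighted_ip_def by (rule arg_cong[where f = "integral _"]) (auto simp: mult_ac)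

lemma weighted_ip_integrable:
  fixes f g :: "real \<Rightarrow> real"
  assumes "continuous_on {a..b} f" "continuous_on {a..b} g"
  shows "(\<lambda>s. (s - a) ^ m * f s * g s) integrable_on {a..b}"
  by (intro integrable_continuous_interval continuous_intros assms)

lemma weighted_ip_sum_left:
  fixes M :: nat
  assumes "\<And>r. r < M \<Longrightarrow> continuous_on {a..b} (g r)" "continuous_on {a..b} h"
  shows "weighted_ip a b m (\<lambda>s. \<Sum>r<M. c r * g r s) h = (\<Sum>r<M. c r * weighted_ip a b m (g r) h)"
proof -
  have int: "(\<lambda>s. c r * ((s - a) ^ m * g r s * h s)) integrable_on {a..b}" if "r < M" for r
    by (intro integrable_on_mult_right weighted_ip_integrable assms that)
  have "(\<Sum>r<M. c r * weighted_ip a b m (g r) h)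
      = (\<Sum>r<M. integral {a..b} (\<lambda>s. c r * ((s - a) ^ m * g r s * h s)))"
    by (simp add: weighted_ip_def)
  also have "\<dots> = integral {a..b} (\<lambda>s. \<Sum>r<M. c r * ((s - a) ^ m * g r s * h s))"
    by (intro integral_sum[symmetric] int) simp_all
  finally show ?thesis
    by (simp add: weighted_ip_def sum_distrib_left sum_distrib_right mult_ac)
qed

lemma weighted_ip_diff_sum_left:
  fixes M :: nat
  assumes f: "continuous_on {a..b} f" and g: "\<And>r. r < M \<Longrightarrow> continuous_on {a..b} (g r)"
    and h: "continuous_on {a..b} h"
  shows "weighted_ip a b m (\<lambda>s. f s - (\<Sum>r<M. c r * g r s)) h
    = weighted_ip a b m f h - (\<Sum>r<M. c r * weighted_ip a b m (g r) h)"
proof -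
  have sum: "continuous_on {a..b} (\<lambda>s. \<Sum>r<M. c r * g r s)"
    by (intro continuous_intros) (simp add: g)
  have "weighted_ip a b m (\<lambda>s. f s - (\<Sum>r<M. c r * g r s)) h
      = weighted_ip a b m f h - weighted_ip a b m (\<lambda>s. \<Sum>r<M. c r * g r s) h"
    using integral_diff[OF weighted_ip_integrable[OF f h] weighted_ip_integrable[OF sum h], of m m]
    by (simp add: weighted_ip_def left_diff_distrib right_diff_distrib)
  then show ?thesis
    by (simp add: weighted_ip_sum_left g h)
qed

section \<open>Gram-Schmidt polynomials: leading coefficient and orthogonality\<close>

text \<open>Every polynomial subtracted from \<open>f_poly a i\<close> has degree below
  \<open>i\<close>, so the leading term survives. The coefficient claim needs the degree bound for
  smaller indices, hence the joint induction; its later use is that \<open>p_poly\<close> is never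
  zero.\<close>

lemma degree_p_poly_le: "degree (p_poly a b m i) \<le> i"
  and coeff_p_poly_self: "coeff (p_poly a b m i) i = 1"
proof (induction i rule: less_induct)
  case (less i)
  let ?S = "\<Sum>j<i. Polynomial.smult (g_coeff a b m i j / chi a b m j) (p_poly a b m j)"
  have p: "p_poly a b m i = f_poly a i - ?S"
    by (rule p_poly_rec)
  have deg_f: "degree (f_poly a i) = i"
    by (simp add: f_poly_def degree_linear_power)
  have "lead_coeff (f_poly a i) = 1"
    by (simp add: f_poly_def lead_coeff_power)
  then have coeff_f: "coeff (f_poly a i) i = 1"
    by (simp add: deg_f)
  { case 1
    have "degree ?S \<le> i"
      by (intro degree_sum_le) (auto intro!: order.trans[OF less(1)])
    then show ?case
      unfolding p by (intro degree_diff_le) (simp_all add: deg_f)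
  }
  { case 2
    have "coeff (p_poly a b m j) i = 0" if "j < i" for j
      using less(1)[OF that] that by (intro coeff_eq_0) simp
    then show ?case
      unfolding p by (simp add: coeff_f coeff_sum)
  }
qed

text \<open>A vanishing integral of a nonnegative continuous function would force infinitely many
  roots on a nonzero polynomial.\<close>

lemma chi_pos:
  assumes "a < b"
  shows "chi a b m i > 0"
proof -
  let ?p = "p_poly a b m i"
  let ?h = "\<lambda>s. (s - a) ^ m * poly ?p s * poly ?p s"
  have nonneg: "?h s \<ge> 0" if "s \<in> {a..b}" for s
    using that by (simp add: mult.assoc)
  have cont: "continuous_on {a..b} ?h"
    by (intro continuous_intros)
  have "integral {a..b} ?h \<noteq> 0"
  proof
    assume "integral {a..b} ?h = 0"
    then have zero: "\<forall>s\<in>{a..b}. ?h s = 0"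
      using integral_eq_0_iff[OF cont assms nonneg] by blast
    \<comment> \<open>The open interval avoids \<open>s = a\<close>, where for \<open>m > 0\<close>
      the weight vanishes and says nothing about the polynomial.\<close>
    have "{a<..<b} \<subseteq> {s. poly ?p s = 0}"
    proof
      fix s assume s: "s \<in> {a<..<b}"
      then have "?h s = 0"
        using zero atLeastAtMost_iff[of s a b] by (metis greaterThanLessThan_iff less_imp_le)
      then show "s \<in> {s. poly ?p s = 0}"
        using s by simp
    qed
    moreover have "?p \<noteq> 0"
      using coeff_p_poly_self[of a b m i] by auto
    ultimately show False
      using poly_roots_finite infinite_Ioo[OF assms] finite_subset by blast
  qed
  moreover have "integral {a..b} ?h \<ge> 0"
    by (intro integral_nonneg integrable_continuous_interval cont nonneg)
  ultimately show ?thesis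
    by (simp add: chi_def inner_m_def)
qed

lemma poly_p_poly:
  "poly (p_poly a b m i) =
     (\<lambda>s. poly (f_poly a i) s - (\<Sum>j<i. g_coeff a b m i j / chi a b m j * poly (p_poly a b m j) s))"
  by (subst p_poly_rec) (simp add: poly_sum fun_eq_iff)

text \<open>Pairing the recursion for index \<open>i\<close> with the polynomial of index
  \<open>j\<close> leaves \<open>g_coeff a b m i j\<close> minus a sum in which, by induction, only
  the term \<open>k = j\<close> survives; that term is again
  \<open>g_coeff a b m i j\<close>.\<close>

lemma p_poly_orthogonal_less:
  assumes "a < b" "j < i"
  shows "weighted_ip a b m (poly (p_poly a b m i)) (poly (p_poly a b m j)) = 0"
  using assms(2)
proof (induction i arbitrary: j rule: less_induct)
  case (less i)
  let ?p = "\<lambda>k. poly (p_poly a b m k)"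
  let ?c = "\<lambda>k. g_coeff a b m i k / chi a b m k"
  have "weighted_ip a b m (?p i) (?p j)
      = g_coeff a b m i j - (\<Sum>k<i. ?c k * weighted_ip a b m (?p k) (?p j))"
    by (subst poly_p_poly, subst weighted_ip_diff_sum_left)
      (auto simp: weighted_ip_poly g_coeff_def intro!: continuous_intros)
  also have "(\<Sum>k<i. ?c k * weighted_ip a b m (?p k) (?p j))
      = (\<Sum>k<i. if k = j then g_coeff a b m i j else 0)"
  proof (intro sum.cong refl)
    fix k assume "k \<in> {..<i}"
    moreover have "weighted_ip a b m (?p k) (?p j) = 0" if "k \<noteq> j" "k < i"
    proof (cases "j < k")
      case True
      then show ?thesis using less.IH that by blast
    next
      \<comment> \<open>Here the larger index is \<open>j\<close>, still below \<open>i\<close>, so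
        the induction hypothesis applies at \<open>j\<close> with the two arguments
        exchanged.\<close>
      case False
      then have "k < j" using that by simp
      then show ?thesis
        using less.IH[of j k] less.prems by (simp add: weighted_ip_commute)
    qed
    ultimately show "?c k * weighted_ip a b m (?p k) (?p j)
        = (if k = j then g_coeff a b m i j else 0)"
      using chi_pos[OF assms(1), of m j]
      by (auto simp: weighted_ip_poly simp flip: chi_def)
  qed
  finally show ?case
    using less.prems by simp
qed

lemma p_poly_orthogonal:
  assumes "a < b"
  shows "weighted_ip a b m (poly (p_poly a b m i)) (poly (p_poly a b m j))
    = (if i = j then chi a b m i else 0)"
  using p_poly_orthogonal_less[OF assms, of i j m] p_poly_orthogonal_less[OF assms, of j i m]
  by (cases i j rule: linorder_cases) (auto simp: weighted_ip_commute weighted_ip_poly chi_def)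

section \<open>Residuals of the orthogonal projection\<close>

text \<open>The polarised form of Bessel's identity. Two functions are needed because a matrix
  \<open>R\<close> with off-diagonal entries couples different components of
  \<open>w\<close>.\<close>

lemma weighted_ip_residuals:
  fixes u v :: "real \<Rightarrow> real" and m M :: nat
  assumes "a < b" and u: "continuous_on {a..b} u" and v: "continuous_on {a..b} v"
  defines "p \<equiv> \<lambda>r. poly (p_poly a b m r)"
  defines "c \<equiv> \<lambda>h r. weighted_ip a b m (p r) h"
  defines "res \<equiv> \<lambda>h s. h s - (\<Sum>r<M. c h r / chi a b m r * p r s)"
  shows "weighted_ip a b m (res u) (res v)
    = weighted_ip a b m u v - (\<Sum>r<M. c u r * c v r / chi a b m r)"
proof -
  have p: "continuous_on {a..b} (p r)" for r
    unfolding p_def by (intro continuous_intros)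
  have res_v: "continuous_on {a..b} (res v)"
    unfolding res_def by (intro continuous_intros v p)
  \<comment> \<open>The residual is orthogonal to the span of the first \<open>M\<close>
    polynomials: its coefficient along \<open>p r\<close> is subtracted exactly.\<close>
  have c_res: "weighted_ip a b m (p r) (res v) = 0" if "r < M" for r
  proof -
    have "weighted_ip a b m (p r) (res v)
        = c v r - (\<Sum>k<M. c v k / chi a b m k * weighted_ip a b m (p k) (p r))"
      unfolding res_def
      by (subst weighted_ip_commute, subst weighted_ip_diff_sum_left)
        (simp_all add: v p c_def weighted_ip_commute)
    also have "\<dots> = c v r - (\<Sum>k<M. if k = r then c v r else 0)"
      using chi_pos[OF assms(1), of m r]
      by (intro arg_cong[where f = "(-) _"] sum.cong) (auto simp: p_def p_poly_orthogonal[OF assms(1)])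
    finally show ?thesis
      using that by simp
  qed
  \<comment> \<open>Expanding the residuals one after the other keeps only one correction sum, since
    the first expansion pairs each \<open>p r\<close> with \<open>res v\<close>.\<close>
  have "weighted_ip a b m (res u) (res v) = weighted_ip a b m u (res v)
      - (\<Sum>r<M. c u r / chi a b m r * weighted_ip a b m (p r) (res v))"
    by (subst (1) res_def, subst weighted_ip_diff_sum_left) (simp_all add: u p res_v)
  also have "\<dots> = weighted_ip a b m (res v) u"
    by (simp add: c_res weighted_ip_commute)
  also have "\<dots> = weighted_ip a b m v u - (\<Sum>r<M. c v r / chi a b m r * c u r)"
    unfolding res_def by (subst weighted_ip_diff_sum_left) (simp_all add: u v p c_def)
  finally show ?thesis
    by (simp add: weighted_ip_commute mult_ac)
qed

section \<open>Inverses of \<open>Lambda_mat\<close> and \<open>G_mat\<close>, change of basis, and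
  the entries of \<open>Xi_mat\<close>\<close>

text \<open>A left inverse of a square matrix is two-sided, so \<open>mat_inverse\<close> cannot
  return \<open>None\<close>, and what it returns equals \<open>B\<close> by uniqueness of
  inverses.\<close>

lemma mat_inv_eqI:
  assumes A: "A \<in> carrier_mat k k" and B: "B \<in> carrier_mat k k" and BA: "B * A = 1\<^sub>m k"
  shows "mat_inv A = B"
proof (cases "mat_inverse A")
  case None
  have "A * B = 1\<^sub>m k"
    using mat_mult_left_right_inverse[OF B A BA] .
  then have "A \<in> Units (ring_mat TYPE(real) k ())"
    using A B BA by (auto simp: Units_def ring_mat_def)
  then show ?thesis
    using mat_inverse(1)[OF A None, of "()"] by blast
next
  case (Some C)
  then have C: "A * C = 1\<^sub>m k" "C \<in> carrier_mat k k"
    using mat_inverse(2)[OF A Some] by auto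
  have "C = (B * A) * C"
    using C BA by simp
  also have "\<dots> = B * (A * C)"
    using A B C by (intro assoc_mult_mat) auto
  also have "\<dots> = B"
    using C B by simp
  finally show ?thesis
    by (simp add: mat_inv_def Some)
qed

lemma mat_inv_Lambda_mat:
  assumes "a < b"
  shows "mat_inv (Lambda_mat a b N m) = mat_diag (N + 1) (\<lambda>r. 1 / chi a b m r)"
proof (rule mat_inv_eqI)
  have "chi a b m r \<noteq> 0" for r
    using chi_pos[OF assms, of m r] by simp
  then show "mat_diag (N + 1) (\<lambda>r. 1 / chi a b m r) * Lambda_mat a b N m = 1\<^sub>m (N + 1)"
    by (simp add: Lambda_mat_def mat_diag_diag)
qed (simp_all add: Lambda_mat_def)

text \<open>The unit triangular shape gives determinant 1, whatever the entries below the diagonal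
  are, so \<open>mat_inv G\<close> is a genuine inverse and not an unspecified value.\<close>

lemma mat_inv_G_mat:
  fixes a b :: real and N m :: nat
  defines "G \<equiv> G_mat a b N m"
  shows "mat_inv G \<in> carrier_mat (N + 1) (N + 1)" and "mat_inv G * G = 1\<^sub>m (N + 1)"
proof -
  have G: "G \<in> carrier_mat (N + 1) (N + 1)"
    by (simp add: G_def G_mat_def)
  have "det G = prod_list (diag_mat G)"
    by (rule det_lower_triangular[OF _ G]) (auto simp: G_def G_mat_def)
  also have "diag_mat G = map (\<lambda>_. 1) [0..<N + 1]"
    unfolding diag_mat_def by (intro map_cong) (auto simp: G_def G_mat_def)
  finally have "det G \<noteq> 0"
    by (simp add: map_replicate_const)
  then obtain B where B: "B \<in> carrier_mat (N + 1) (N + 1)" "B * G = 1\<^sub>m (N + 1)"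
    using det_non_zero_imp_unit[OF G, where b = "()"] by (auto simp: Units_def ring_mat_def)
  then show "mat_inv G \<in> carrier_mat (N + 1) (N + 1)" "mat_inv G * G = 1\<^sub>m (N + 1)"
    using mat_inv_eqI[OF G] by auto
qed

text \<open>The Gram-Schmidt recursion solved for \<open>f_poly\<close>: row \<open>k\<close> of
  \<open>G_mat\<close> holds the recursion coefficients, and its diagonal 1 accounts for
  \<open>p_poly a b m k\<close> itself.\<close>

lemma f_poly_eq_sum_G_mat:
  assumes "k < N + 1"
  shows "poly (f_poly a k) s = (\<Sum>r<N + 1. G_mat a b N m $$ (k, r) * poly (p_poly a b m r) s)"
proof -
  let ?t = "\<lambda>r. G_mat a b N m $$ (k, r) * poly (p_poly a b m r) s"
  have "(\<Sum>r<N + 1. ?t r) = (\<Sum>r<Suc k. ?t r)"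
    using assms by (intro sum.mono_neutral_right) (auto simp: G_mat_def)
  also have "\<dots> = (\<Sum>r<k. g_coeff a b m k r / chi a b m r * poly (p_poly a b m r) s)
      + poly (p_poly a b m k) s"
    using assms by (simp add: G_mat_def)
  also have "\<dots> = poly (f_poly a k) s"
    by (subst (2) poly_p_poly) simp
  finally show ?thesis
    by simp
qed

text \<open>Linearity carries the change of basis over to moments, and inverting
  \<open>G_mat\<close> recovers the projection coefficients from the moments that make up
  \<open>F_int\<close>.\<close>

lemma mat_inv_G_mat_moments:
  assumes "r < N + 1" and v: "continuous_on {a..b} v"
  shows "(\<Sum>k<N + 1. mat_inv (G_mat a b N m) $$ (r, k) * weighted_ip a b m (poly (f_poly a k)) v)
    = weighted_ip a b m (poly (p_poly a b m r)) v"
proof -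
  define G where "G = G_mat a b N m"
  define H where "H = mat_inv G"
  define c where "c q = weighted_ip a b m (poly (p_poly a b m q)) v" for q
  have G: "G \<in> carrier_mat (N + 1) (N + 1)"
    by (simp add: G_def G_mat_def)
  note H = mat_inv_G_mat[of a b N m, folded G_def, folded H_def]
  have HG: "(\<Sum>k<N + 1. H $$ (r, k) * G $$ (k, q)) = (if r = q then 1 else 0)" if "q < N + 1" for q
  proof -
    have "(H * G) $$ (r, q) = (\<Sum>k<N + 1. H $$ (r, k) * G $$ (k, q))"
      using assms(1) that H(1) G by (simp add: scalar_prod_def atLeast0LessThan)
    then show ?thesis
      using assms(1) that H(2) by simp
  qed
  have "weighted_ip a b m (poly (f_poly a k)) v = (\<Sum>q<N + 1. G $$ (k, q) * c q)"
    if "k < N + 1" for k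
  proof -
    have "poly (f_poly a k) = (\<lambda>s. \<Sum>q<N + 1. G $$ (k, q) * poly (p_poly a b m q) s)"
      using f_poly_eq_sum_G_mat[OF that] by (auto simp: G_def)
    then show ?thesis
      unfolding c_def
      by (simp only:) (rule weighted_ip_sum_left; auto intro!: continuous_intros v)
  qed
  then have "(\<Sum>k<N + 1. H $$ (r, k) * weighted_ip a b m (poly (f_poly a k)) v)
      = (\<Sum>k<N + 1. \<Sum>q<N + 1. H $$ (r, k) * G $$ (k, q) * c q)"
    by (simp add: sum_distrib_left mult.assoc del: sum.lessThan_Suc)
  \<comment> \<open>Exchanging the sums exposes the entries of \<open>H * G\<close>, the identity
    matrix.\<close>
  also have "\<dots> = (\<Sum>q<N + 1. (\<Sum>k<N + 1. H $$ (r, k) * G $$ (k, q)) * c q)"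
    by (subst sum.swap) (simp add: sum_distrib_right del: sum.lessThan_Suc)
  also have "\<dots> = (\<Sum>q<N + 1. (if r = q then 1 else 0) * c q)"
    by (intro sum.cong refl) (simp only: HG lessThan_iff)
  also have "\<dots> = (\<Sum>q<N + 1. if r = q then c q else 0)"
    by (intro sum.cong) auto
  also have "\<dots> = c r"
    using assms(1) by (subst sum.delta') auto
  finally show ?thesis
    by (simp only: H_def G_def c_def)
qed

text \<open>Exhibits \<open>Xi_mat\<close> as a sum over \<open>r\<close> of rank-one matrices
  weighted by \<open>1 / chi a b m r\<close>, one for each orthogonal polynomial.\<close>

lemma Xi_mat_index:
  fixes a b :: real and N m :: nat
  assumes "a < b" "k < N + 1" "l < N + 1"
  defines "H \<equiv> mat_inv (G_mat a b N m)"
  shows "Xi_mat a b N m $$ (k, l) = (\<Sum>r<N + 1. H $$ (r, k) * H $$ (r, l) / chi a b m r)"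
proof -
  have H: "H \<in> carrier_mat (N + 1) (N + 1)"
    unfolding H_def by (rule mat_inv_G_mat)
  have "H\<^sup>T * mat_diag (N + 1) (\<lambda>r. 1 / chi a b m r)
      = mat (N + 1) (N + 1) (\<lambda>(i, j). H\<^sup>T $$ (i, j) * (1 / chi a b m j))"
    using H by (intro mat_diag_mult_right) simp
  then have "Xi_mat a b N m = mat (N + 1) (N + 1) (\<lambda>(i, j). H\<^sup>T $$ (i, j) * (1 / chi a b m j)) * H"
    by (simp add: Xi_mat_def mat_inv_Lambda_mat[OF assms(1)] flip: H_def)
  then show ?thesis
    using H assms(2,3) by (simp add: scalar_prod_def atLeast0LessThan del: sum.lessThan_Suc)
qed

lemma Xi_mat_carrier: "a < b \<Longrightarrow> Xi_mat a b N m \<in> carrier_mat (N + 1) (N + 1)"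
  unfolding Xi_mat_def mat_inv_Lambda_mat
  using mat_inv_G_mat(1)[of a b N m] by (intro mult_carrier_mat) auto

section \<open>Quadratic forms of Kronecker products\<close>

lemma quadratic_form_eq_sum:
  fixes A :: "real mat"
  assumes "A \<in> carrier_mat n n" "x \<in> carrier_vec n"
  shows "x \<bullet> (A *\<^sub>v x) = (\<Sum>i<n. \<Sum>j<n. x $ i * A $$ (i, j) * x $ j)"
  using assms by (simp add: scalar_prod_def atLeast0LessThan sum_distrib_left mult.assoc)

text \<open>Decodes the flat index of a Kronecker product as \<open>x = k * n + i\<close>, with
  block \<open>k\<close> and position \<open>i\<close> inside it. For \<open>n = 0\<close> both
  sides are empty sums.\<close>

lemma sum_div_mod:
  fixes f :: "nat \<Rightarrow> nat \<Rightarrow> 'a :: comm_monoid_add"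
  shows "(\<Sum>x<M * n. f (x div n) (x mod n)) = (\<Sum>k<M. \<Sum>i<n. f k i)"
proof -
  have "(\<Sum>x<M * n. f (x div n) (x mod n))
      = (\<Sum>k<M. \<Sum>x\<in>{k * n..<k * n + n}. f (x div n) (x mod n))"
    by (rule sum.nat_group[symmetric])
  also have "\<dots> = (\<Sum>k<M. \<Sum>i<n. f k i)"
  proof (rule sum.cong[OF refl])
    fix k
    have "(\<Sum>x\<in>{k * n..<k * n + n}. f (x div n) (x mod n))
        = (\<Sum>i<n. f ((i + k * n) div n) ((i + k * n) mod n))"
      using sum.shift_bounds_nat_ivl[of "\<lambda>x. f (x div n) (x mod n)" 0 "k * n" n]
      by (simp add: atLeast0LessThan add.commute)
    also have "\<dots> = (\<Sum>i<n. f k i)"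
      by (intro sum.cong) auto
    finally show "(\<Sum>x\<in>{k * n..<k * n + n}. f (x div n) (x mod n)) = (\<Sum>i<n. f k i)" .
  qed
  finally show ?thesis .
qed

text \<open>Describing the vector by its blocks through \<open>\<phi>\<close> lets
  \<open>sum_div_mod\<close> split the column index first and then the row index.\<close>

lemma quadratic_form_kron_mat:
  fixes \<phi> :: "nat \<Rightarrow> nat \<Rightarrow> real"
  assumes A: "A \<in> carrier_mat M M" and B: "B \<in> carrier_mat n n"
  defines "x \<equiv> vec (M * n) (\<lambda>i. \<phi> (i div n) (i mod n))"
  shows "x \<bullet> ((A \<otimes>\<^sub>m B) *\<^sub>v x)
    = (\<Sum>k<M. \<Sum>i<n. \<Sum>l<M. \<Sum>j<n. \<phi> k i * (A $$ (k, l) * B $$ (i, j)) * \<phi> l j)"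
proof -
  have "x \<bullet> ((A \<otimes>\<^sub>m B) *\<^sub>v x)
      = (\<Sum>i<M * n. \<Sum>j<M * n. x $ i * (A \<otimes>\<^sub>m B) $$ (i, j) * x $ j)"
    using A B by (intro quadratic_form_eq_sum) (auto simp: x_def kron_mat_def)
  also have "\<dots> = (\<Sum>i<M * n. \<Sum>j<M * n. \<phi> (i div n) (i mod n)
      * (A $$ (i div n, j div n) * B $$ (i mod n, j mod n)) * \<phi> (j div n) (j mod n))"
    using A B by (intro sum.cong refl) (simp add: x_def kron_mat_def)
  also have "\<dots> = (\<Sum>i<M * n. \<Sum>l<M. \<Sum>j<n. \<phi> (i div n) (i mod n)
      * (A $$ (i div n, l) * B $$ (i mod n, j)) * \<phi> l j)"
    by (rule sum.cong[OF refl], rule sum_div_mod)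
  also have "\<dots> = (\<Sum>k<M. \<Sum>i<n. \<Sum>l<M. \<Sum>j<n. \<phi> k i * (A $$ (k, l) * B $$ (i, j)) * \<phi> l j)"
    by (rule sum_div_mod)
  finally show ?thesis .
qed

lemma F_int_eq:
  fixes w :: "real \<Rightarrow> real vec"
  assumes "\<And>s. s \<in> {a..b} \<Longrightarrow> w s \<in> carrier_vec n"
  shows "F_int a b n N m w = vec ((N + 1) * n)
    (\<lambda>i. weighted_ip a b m (poly (f_poly a (i div n))) (\<lambda>s. w s $ (i mod n)))"
  unfolding F_int_def integral_vec_def weighted_ip_def
proof (intro eq_vecI; clarsimp)
  \<comment> \<open>The bound is the simplified form of \<open>(N + 1) * n\<close>.\<close>
  fix i assume i: "i < n + N * n"
  then have "i div n < N + 1"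
    by (simp add: less_mult_imp_div_less)
  moreover have "dim_vec (w s) = n" if "s \<in> {a..b}" for s
    using assms[OF that] by simp
  ultimately show "integral {a..b} (\<lambda>s. ((s - a) ^ m \<cdot>\<^sub>v (F_vec a N s \<otimes>\<^sub>v w s)) $ i)
      = integral {a..b} (\<lambda>s. (s - a) ^ m * poly (f_poly a (i div n)) s * w s $ (i mod n))"
    using i by (intro integral_cong) (simp add: kron_vec_def F_vec_def)
qed

text \<open>The right-hand side of the inequality becomes a sum over pairs of components with
  coefficients \<open>R $$ (i, j)\<close>, the shape that matches the correction term of
  \<open>weighted_ip_residuals\<close>.\<close>

lemma quadratic_form_Xi_mat_kron:
  fixes a b :: real and m :: nat and w :: "real \<Rightarrow> real vec"
  assumes "a < b" and R: "R \<in> carrier_mat n n" and w: "continuous_on_vec n {a..b} w"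
  defines "c \<equiv> \<lambda>r i. weighted_ip a b m (poly (p_poly a b m r)) (\<lambda>s. w s $ i)"
  shows "F_int a b n N m w \<bullet> ((Xi_mat a b N m \<otimes>\<^sub>m R) *\<^sub>v F_int a b n N m w)
    = (\<Sum>i<n. \<Sum>j<n. R $$ (i, j) * (\<Sum>r<N + 1. c r i * c r j / chi a b m r))"
proof -
  define H where "H = mat_inv (G_mat a b N m)"
  define \<phi> where "\<phi> k i = weighted_ip a b m (poly (f_poly a k)) (\<lambda>s. w s $ i)" for k i
  define M where "M = N + 1"
  have F: "F_int a b n N m w = vec (M * n) (\<lambda>i. \<phi> (i div n) (i mod n))"
    using w unfolding M_def \<phi>_def by (intro F_int_eq) (auto simp: continuous_on_vec_def)
  have c: "c r i = (\<Sum>k<M. H $$ (r, k) * \<phi> k i)" if "r < M" "i < n" for r i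
    using w that mat_inv_G_mat_moments[of r N a b "\<lambda>s. w s $ i" m]
    unfolding c_def H_def \<phi>_def M_def by (auto simp: continuous_on_vec_def)
  have "F_int a b n N m w \<bullet> ((Xi_mat a b N m \<otimes>\<^sub>m R) *\<^sub>v F_int a b n N m w)
      = (\<Sum>k<M. \<Sum>i<n. \<Sum>l<M. \<Sum>j<n. \<phi> k i * (Xi_mat a b N m $$ (k, l) * R $$ (i, j)) * \<phi> l j)"
    unfolding F by (rule quadratic_form_kron_mat)
      (simp_all add: R M_def Xi_mat_carrier assms(1) del: One_nat_def add_Suc_right)
  \<comment> \<open>Three exchanges bring \<open>i\<close> and \<open>j\<close> outermost, so that
    the block sums can be treated for a fixed entry of \<open>R\<close>.\<close>
  also have "\<dots> = (\<Sum>k<M. \<Sum>i<n. \<Sum>j<n. \<Sum>l<M. \<phi> k i * (Xi_mat a b N m $$ (k, l) * R $$ (i, j)) * \<phi> l j)"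
    by (intro sum.cong refl sum.swap)
  also have "\<dots> = (\<Sum>i<n. \<Sum>k<M. \<Sum>j<n. \<Sum>l<M. \<phi> k i * (Xi_mat a b N m $$ (k, l) * R $$ (i, j)) * \<phi> l j)"
    by (rule sum.swap)
  also have "\<dots> = (\<Sum>i<n. \<Sum>j<n. \<Sum>k<M. \<Sum>l<M. \<phi> k i * (Xi_mat a b N m $$ (k, l) * R $$ (i, j)) * \<phi> l j)"
    by (intro sum.cong refl sum.swap)
  also have "\<dots> = (\<Sum>i<n. \<Sum>j<n. R $$ (i, j) * (\<Sum>r<M. c r i * c r j / chi a b m r))"
  proof (intro sum.cong refl)
    fix i j assume ij: "i \<in> {..<n}" "j \<in> {..<n}"
    let ?t = "\<lambda>k l r. R $$ (i, j) * ((H $$ (r, k) * \<phi> k i) * (H $$ (r, l) * \<phi> l j) / chi a b m r)"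
    have "(\<Sum>k<M. \<Sum>l<M. \<phi> k i * (Xi_mat a b N m $$ (k, l) * R $$ (i, j)) * \<phi> l j)
        = (\<Sum>k<M. \<Sum>l<M. \<Sum>r<M. ?t k l r)"
      by (intro sum.cong refl)
        (simp add: Xi_mat_index[OF assms(1)] sum_distrib_left sum_distrib_right M_def H_def mult_ac
          del: sum.lessThan_Suc)
    also have "\<dots> = (\<Sum>k<M. \<Sum>r<M. \<Sum>l<M. ?t k l r)"
      by (intro sum.cong refl sum.swap)
    also have "\<dots> = (\<Sum>r<M. \<Sum>k<M. \<Sum>l<M. ?t k l r)"
      by (rule sum.swap)
    \<comment> \<open>For fixed \<open>r\<close> the double sum over \<open>k\<close> and
      \<open>l\<close> factors, and each factor is a projection coefficient by
      \<open>c\<close>.\<close>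
    also have "\<dots> = (\<Sum>r<M. R $$ (i, j) *
        ((\<Sum>k<M. H $$ (r, k) * \<phi> k i) * (\<Sum>l<M. H $$ (r, l) * \<phi> l j) / chi a b m r))"
      by (simp only: sum_product) (simp only: sum_distrib_left sum_divide_distrib)
    also have "\<dots> = R $$ (i, j) * (\<Sum>r<M. c r i * c r j / chi a b m r)"
      using ij by (simp add: c sum_distrib_left)
    finally show "(\<Sum>k<M. \<Sum>l<M. \<phi> k i * (Xi_mat a b N m $$ (k, l) * R $$ (i, j)) * \<phi> l j)
        = R $$ (i, j) * (\<Sum>r<M. c r i * c r j / chi a b m r)" .
  qed
  finally show ?thesis
    by (simp only: M_def)
qed

section \<open>Integrated quadratic forms and the inequality\<close>

lemma pos_def_mat_nonneg:
  assumes "pos_def_mat R" "R \<in> carrier_mat n n" "x \<in> carrier_vec n"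
  shows "x \<bullet> (R *\<^sub>v x) \<ge> 0"
proof (cases "x = 0\<^sub>v n")
  case True
  then show ?thesis using assms(2) by simp
next
  case False
  then show ?thesis using assms by (auto simp: pos_def_mat_def intro: less_imp_le)
qed

text \<open>Reduces vector integrals to scalar inner products of components; it serves both for
  \<open>w\<close> and for its residual.\<close>

lemma integral_quadratic_form:
  fixes w :: "real \<Rightarrow> real vec"
  assumes R: "R \<in> carrier_mat n n" and w: "continuous_on_vec n {a..b} w"
  shows "integral {a..b} (\<lambda>s. (s - a) ^ m * (w s \<bullet> (R *\<^sub>v w s)))
    = (\<Sum>i<n. \<Sum>j<n. R $$ (i, j) * weighted_ip a b m (\<lambda>s. w s $ i) (\<lambda>s. w s $ j))"
proof -
  have int: "(\<lambda>s. R $$ (i, j) * ((s - a) ^ m * w s $ i * w s $ j)) integrable_on {a..b}"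
    if "i < n" "j < n" for i j
    using w that
    by (intro integrable_on_mult_right weighted_ip_integrable) (auto simp: continuous_on_vec_def)
  have "integral {a..b} (\<lambda>s. (s - a) ^ m * (w s \<bullet> (R *\<^sub>v w s)))
      = integral {a..b} (\<lambda>s. \<Sum>i<n. \<Sum>j<n. R $$ (i, j) * ((s - a) ^ m * w s $ i * w s $ j))"
  proof (intro integral_cong)
    fix s assume "s \<in> {a..b}"
    then have "w s \<in> carrier_vec n"
      using w by (auto simp: continuous_on_vec_def)
    then show "(s - a) ^ m * (w s \<bullet> (R *\<^sub>v w s))
        = (\<Sum>i<n. \<Sum>j<n. R $$ (i, j) * ((s - a) ^ m * w s $ i * w s $ j))"
      by (simp add: quadratic_form_eq_sum[OF R] sum_distrib_left mult_ac)
  qed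
  also have "\<dots> = (\<Sum>i<n. \<Sum>j<n. R $$ (i, j) * weighted_ip a b m (\<lambda>s. w s $ i) (\<lambda>s. w s $ j))"
  proof -
    have "integral {a..b} (\<lambda>s. \<Sum>i<n. \<Sum>j<n. R $$ (i, j) * ((s - a) ^ m * w s $ i * w s $ j))
        = (\<Sum>i<n. integral {a..b} (\<lambda>s. \<Sum>j<n. R $$ (i, j) * ((s - a) ^ m * w s $ i * w s $ j)))"
      by (intro integral_sum integrable_sum finite_lessThan int) simp_all
    also have "\<dots> = (\<Sum>i<n. \<Sum>j<n. integral {a..b} (\<lambda>s. R $$ (i, j) * ((s - a) ^ m * w s $ i * w s $ j)))"
      by (intro sum.cong refl integral_sum finite_lessThan int) simp_all
    finally show ?thesis
      by (simp add: weighted_ip_def)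
  qed
  finally show ?thesis .
qed

theorem theorem2p2:
  fixes a b :: real and n N m :: nat and R :: "real mat" and w :: "real \<Rightarrow> real vec"
  assumes "a < b"
    and "R \<in> carrier_mat n n"
    and "symmetric_mat R"
    and "pos_def_mat R"
    and "continuous_on_vec n {a..b} w"
  shows "integral {a..b} (\<lambda>s. (s - a) ^ m * (w s \<bullet> (R *\<^sub>v w s)))
           \<ge> F_int a b n N m w \<bullet> ((Xi_mat a b N m \<otimes>\<^sub>m R) *\<^sub>v F_int a b n N m w)"
proof -
  define p where "p r = poly (p_poly a b m r)" for r
  define c where "c r i = weighted_ip a b m (p r) (\<lambda>s. w s $ i)" for r i
  \<comment> \<open>Building \<open>z s\<close> with \<open>vec n\<close> fixes its dimension for
    every real \<open>s\<close>, also outside \<open>{a..b}\<close>, so \<open>z_dim\<close> can be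
    used without a side condition.\<close>
  define z where "z s = vec n (\<lambda>i. w s $ i - (\<Sum>r<N + 1. c r i / chi a b m r * p r s))" for s
  have w: "continuous_on {a..b} (\<lambda>s. w s $ i)" if "i < n" for i
    using assms(5) that by (auto simp: continuous_on_vec_def)
  have z_dim: "z s \<in> carrier_vec n" for s
    by (simp add: z_def)
  have z: "continuous_on_vec n {a..b} z"
    unfolding continuous_on_vec_def
    by (auto simp: z_def p_def divide_inverse simp del: sum.lessThan_Suc
        intro!: continuous_intros w)
  have "continuous_on {a..b} (\<lambda>s. (s - a) ^ m * (z s \<bullet> (R *\<^sub>v z s)))"
    using z unfolding quadratic_form_eq_sum[OF assms(2) z_dim] continuous_on_vec_def
    by (auto intro!: continuous_intros)
  then have "0 \<le> integral {a..b} (\<lambda>s. (s - a) ^ m * (z s \<bullet> (R *\<^sub>v z s)))"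
    using pos_def_mat_nonneg[OF assms(4,2) z_dim]
    by (intro integral_nonneg integrable_continuous_interval) auto
  also have "\<dots> = (\<Sum>i<n. \<Sum>j<n. R $$ (i, j) * weighted_ip a b m (\<lambda>s. z s $ i) (\<lambda>s. z s $ j))"
    by (rule integral_quadratic_form[OF assms(2) z])
  \<comment> \<open>Bessel's identity is applied to each pair of components separately, with the
    entry of \<open>R\<close> as a fixed factor.\<close>
  also have "\<dots> = (\<Sum>i<n. \<Sum>j<n. R $$ (i, j) * (weighted_ip a b m (\<lambda>s. w s $ i) (\<lambda>s. w s $ j)
      - (\<Sum>r<N + 1. c r i * c r j / chi a b m r)))"
  proof (intro sum.cong refl arg_cong[where f = "(*) _"])
    fix i j assume "i \<in> {..<n}" "j \<in> {..<n}"
    then show "weighted_ip a b m (\<lambda>s. z s $ i) (\<lambda>s. z s $ j)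
        = weighted_ip a b m (\<lambda>s. w s $ i) (\<lambda>s. w s $ j) - (\<Sum>r<N + 1. c r i * c r j / chi a b m r)"
      using weighted_ip_residuals[OF assms(1) w w, of i j m "N + 1"]
      by (simp add: z_def c_def p_def del: sum.lessThan_Suc)
  qed
  also have "\<dots> = integral {a..b} (\<lambda>s. (s - a) ^ m * (w s \<bullet> (R *\<^sub>v w s)))
      - F_int a b n N m w \<bullet> ((Xi_mat a b N m \<otimes>\<^sub>m R) *\<^sub>v F_int a b n N m w)"
    by (simp add: integral_quadratic_form[OF assms(2,5)] quadratic_form_Xi_mat_kron[OF assms(1,2,5)]
        c_def p_def right_diff_distrib sum_subtractf del: sum.lessThan_Suc)
  finally show ?thesis
    by simp
qed

end
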